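(* Let $K$ be a field and let $H=(H^0,H^1,s,r)$ be a hypergraph with Leavitt path algebra $L_K(H)$. Then: (i) $L_K(H)$ has a set of local units, namely the set of all finite sums of distinct elements of $H^0$. If $H$ is finite, then $L_K(H)$ is a unital ring with $\sum_{v\in H^0}v$ as multiplicative identity. (ii) There is a $K$-linear involution $*$ on $L_K(H)$ mapping $v\mapsto v$, $h_{ij}\mapsto h_{ij}^*$ and $h_{ij}^*\mapsto h_{ij}$ for any $v\in H^0$, $h\in H^1$, $1\leq i\leq |s(h)|$ and $1\leq j\leq |r(h)|$. (iii) Set $n:=\sup\{|s(h)|\mid h\in H^1\}$ (which may be infinity). One can define a $\mathbb Z^n$-grading on $L_K(H)$ by setting $\deg(v):=0$, $\deg(h_{ij}):=\alpha_i$ and $\deg(h_{ij}^* ):=-\alpha_i$ for any $v\in H^0$, $h\in H^1$, $1\leq i\leq |s(h)|$ and $1\leq j\leq |r(h)|$. Here $\alpha_i$ denotes the element of $\mathbb Z^n$ whose $i$-th component is $1$ and whose other components are $0$.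
   Context: Rings and algebras are associative but not necessarily commutative or unital. A multiset over a set $X$ is a function $M:X\to\mathbb N_0$ (nonnegative integers); its support is $M_{\mathrm{supp}}=\{x\in X\mid M(x)>0\}$. $\mathrm{Mult}(X)$ is the set of multisets over $X$ with finite, nonempty support, and $|M|=\sum_{x\in M_{\mathrm{supp}}}M(x)$ for $M\in\mathrm{Mult}(X)$. A (directed) hypergraph is a quadruple $H=(H^0,H^1,s,r)$ where $H^0,H^1$ are sets (of vertices and hyperedges) and $s,r:H^1\to\mathrm{Mult}(H^0)$ are maps; $H$ is finite if $H^0$ and $H^1$ are finite. All hypergraphs are assumed nonempty (not $H^0=H^1=\emptyset$). For each $h\in H^1$ fix listings with multiplicity $s(h)=\{s(h)_1,\dots,s(h)_{|s(h)|}\}$ and $r(h)=\{r(h)_1,\dots,r(h)_{|r(h)|}\}$. The Leavitt path algebra $L_K(H)$ is the (not necessarily unital) $K$-algebra presented by the generators $v,h_{ij},h_{ij}^*$ ($v\in H^0$, $h\in H^1$, $1\le i\le|s(h)|$, $1\le j\le|r(h)|$) and the relations: (i) $uv=\delta_{uv}u$ ($u,v\in H^0$); (ii) $s(h)_ih_{ij}=h_{ij}=h_{ij}r(h)_j$ and $r(h)_jh_{ij}^*=h_{ij}^*=h_{ij}^*s(h)_i$ for all $h,i,j$; (iii) $\sum_{k=1}^{|r(h)|}h_{ik}h_{jk}^*=\delta_{ij}s(h)_i$ ($h\in H^1$, $1\le i,j\le|s(h)|$); (iv) $\sum_{k=1}^{|s(h)|}h_{ki}^*h_{kj}=\delta_{ij}r(h)_i$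 ($h\in H^1$, $1\le i,j\le|r(h)|$). A set $Y$ of idempotents of a ring $R$ is a set of local units if for each finite subset $S\subseteq R$ there is $x\in Y$ with $xsx=s$ for all $s\in S$. An involution is an additive anti-multiplicative map equal to its own inverse. If $n=\infty$, $\mathbb Z^n$ denotes the direct sum of countably many copies of $\mathbb Z$. *)

theory Defs
  imports
    "HOL-Algebra.Algebra"
    "HOL-Algebra.Algebraic_Closure_Type"
    "HOL-Library.Poly_Mapping"
    "HOL-Library.Extended_Nat"
    "HOL-Library.Multiset"
begin

section \<open>Presented associative algebras without unit\<close>

text \<open>
  With words forming a monoid under concatenation, the type \<^typ>\<open>'x list \<Rightarrow>\<^sub>0 'k\<close> with its library
  multiplication (convolution) is the free unital algebra on all of \<^typ>\<open>'x\<close>. The free non-unital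
  algebra on a set \<open>B\<close> consists of the combinations of nonempty words over \<open>B\<close>.
\<close>

instantiation list :: (type) monoid_add
begin

definition zero_list :: "'a list" where "zero_list = []"

definition plus_list :: "'a list \<Rightarrow> 'a list \<Rightarrow> 'a list" where "plus_list xs ys = xs @ ys"

instance by standard (simp_all add: zero_list_def plus_list_def)

end

definition free_algebra :: "'x set \<Rightarrow> ('x list \<Rightarrow>\<^sub>0 'k::field) set" where
  "free_algebra B = {p. \<forall>w \<in> Poly_Mapping.keys p. w \<noteq> [] \<and> set w \<subseteq> B}"

definition scale :: "'k::field \<Rightarrow> ('x list \<Rightarrow>\<^sub>0 'k) \<Rightarrow> ('x list \<Rightarrow>\<^sub>0 'k)" where
  "scale c p = Poly_Mapping.single [] c * p"

definition letter :: "'x \<Rightarrow> ('x list \<Rightarrow>\<^sub>0 'k::field)" where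
  "letter x = Poly_Mapping.single [x] 1"

inductive_set relation_ideal :: "'x set \<Rightarrow> ('x list \<Rightarrow>\<^sub>0 'k::field) set \<Rightarrow> ('x list \<Rightarrow>\<^sub>0 'k) set"
  for B R where
  zero: "0 \<in> relation_ideal B R"
| relator: "p \<in> R \<Longrightarrow> p \<in> relation_ideal B R"
| add: "p \<in> relation_ideal B R \<Longrightarrow> q \<in> relation_ideal B R \<Longrightarrow> p + q \<in> relation_ideal B R"
| scale: "p \<in> relation_ideal B R \<Longrightarrow> scale c p \<in> relation_ideal B R"
| mult_left: "p \<in> relation_ideal B R \<Longrightarrow> a \<in> free_algebra B \<Longrightarrow> a * p \<in> relation_ideal B R"
| mult_right: "p \<in> relation_ideal B R \<Longrightarrow> a \<in> free_algebra B \<Longrightarrow> p * a \<in> relation_ideal B R"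

definition residue_class ::
    "'x set \<Rightarrow> ('x list \<Rightarrow>\<^sub>0 'k::field) set \<Rightarrow> ('x list \<Rightarrow>\<^sub>0 'k) \<Rightarrow> ('x list \<Rightarrow>\<^sub>0 'k) set" where
  "residue_class B R p = {q. q - p \<in> relation_ideal B R}"

text \<open>
  The quotient of the free non-unital algebra on \<open>B\<close> by the ideal generated by \<open>R\<close> (for
  \<open>R \<subseteq> free_algebra B\<close>). There need not be a unit, so the field \<^const>\<open>one\<close> of the record is
  left unspecified.
\<close>

definition presented_algebra ::
    "'x set \<Rightarrow> ('x list \<Rightarrow>\<^sub>0 'k::field) set \<Rightarrow> ('k, ('x list \<Rightarrow>\<^sub>0 'k) set) module" where
  "presented_algebra B R =
    \<lparr> carrier = residue_class B R ` free_algebra B,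
      monoid.mult = (\<lambda>P Q. \<Union>p\<in>P. \<Union>q\<in>Q. residue_class B R (p * q)),
      one = undefined,
      ring.zero = residue_class B R 0,
      add = (\<lambda>P Q. \<Union>p\<in>P. \<Union>q\<in>Q. residue_class B R (p + q)),
      module.smult = (\<lambda>c P. \<Union>p\<in>P. residue_class B R (scale c p)) \<rparr>"


section \<open>Local units, involutions and gradings\<close>

definition set_of_local_units :: "('a, 'm) ring_scheme \<Rightarrow> 'a set \<Rightarrow> bool" where
  "set_of_local_units A Y \<longleftrightarrow>
     Y \<subseteq> carrier A \<and>
     (\<forall>x\<in>Y. x \<otimes>\<^bsub>A\<^esub> x = x) \<and>
     (\<forall>S. finite S \<and> S \<subseteq> carrier A \<longrightarrow> (\<exists>x\<in>Y. \<forall>s\<in>S. (x \<otimes>\<^bsub>A\<^esub> s) \<otimes>\<^bsub>A\<^esub> x = s))"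

definition linear_involution :: "('k, 'a, 'm) module_scheme \<Rightarrow> ('a \<Rightarrow> 'a) \<Rightarrow> bool" where
  "linear_involution A f \<longleftrightarrow>
     f \<in> carrier A \<rightarrow> carrier A \<and>
     (\<forall>x\<in>carrier A. \<forall>y\<in>carrier A. f (x \<oplus>\<^bsub>A\<^esub> y) = f x \<oplus>\<^bsub>A\<^esub> f y) \<and>
     (\<forall>x\<in>carrier A. \<forall>y\<in>carrier A. f (x \<otimes>\<^bsub>A\<^esub> y) = f y \<otimes>\<^bsub>A\<^esub> f x) \<and>
     (\<forall>c. \<forall>x\<in>carrier A. f (c \<odot>\<^bsub>A\<^esub> x) = c \<odot>\<^bsub>A\<^esub> f x) \<and>
     (\<forall>x\<in>carrier A. f (f x) = x)"

text \<open>
  The second conjunct says that the algebra is the direct sum of the components; extensionality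
  on \<open>carrier G\<close> makes the family of homogeneous parts unique as a function.
\<close>

definition algebra_grading ::
    "('g, 'l) monoid_scheme \<Rightarrow> ('k::field, 'a, 'm) module_scheme \<Rightarrow> ('g \<Rightarrow> 'a set) \<Rightarrow> bool" where
  "algebra_grading G A D \<longleftrightarrow>
     (\<forall>g\<in>carrier G. submodule (D g) (ring_of_type_algebra :: 'k ring) A) \<and>
     (\<forall>x\<in>carrier A. \<exists>!f. f \<in> (\<Pi>\<^sub>E g\<in>carrier G. D g) \<and>
        finite {g \<in> carrier G. f g \<noteq> \<zero>\<^bsub>A\<^esub>} \<and>
        x = finsum A f {g \<in> carrier G. f g \<noteq> \<zero>\<^bsub>A\<^esub>}) \<and>
     (\<forall>g\<in>carrier G. \<forall>h\<in>carrier G. \<forall>x\<in>D g. \<forall>y\<in>D h. x \<otimes>\<^bsub>A\<^esub> y \<in> D (g \<otimes>\<^bsub>G\<^esub> h))"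

text \<open>
  \<open>\<int>\<^sup>n\<close> for \<open>0 \<le> n \<le> \<infinity>\<close>, with coordinates numbered from 1. Its elements are finitely supported,
  so \<open>n = \<infinity>\<close> gives the direct sum; the standard basis vectors are \<^term>\<open>frag_of i\<close>.
\<close>

definition int_power :: "enat \<Rightarrow> (nat \<Rightarrow>\<^sub>0 int) monoid" where
  "int_power n = free_Abelian_group {i. 1 \<le> i \<and> enat i \<le> n}"


section \<open>Hypergraphs and their Leavitt path algebras\<close>

record ('v, 'e) hypergraph =
  verts :: "'v set"
  hyperedges :: "'e set"
  source :: "'e \<Rightarrow> 'v multiset"
  target :: "'e \<Rightarrow> 'v multiset"

definition hypergraph :: "('v, 'e) hypergraph \<Rightarrow> bool" where
  "hypergraph H \<longleftrightarrow>
     (verts H \<noteq> {} \<or> hyperedges H \<noteq> {}) \<and>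
     (\<forall>h\<in>hyperedges H. source H h \<noteq> {#} \<and> set_mset (source H h) \<subseteq> verts H \<and>
        target H h \<noteq> {#} \<and> set_mset (target H h) \<subseteq> verts H)"

definition finite_hypergraph :: "('v, 'e) hypergraph \<Rightarrow> bool" where
  "finite_hypergraph H \<longleftrightarrow> finite (verts H) \<and> finite (hyperedges H)"

text \<open>The chosen listings with multiplicity of the sources and ranges.\<close>

definition listings :: "('v, 'e) hypergraph \<Rightarrow> ('e \<Rightarrow> 'v list) \<Rightarrow> ('e \<Rightarrow> 'v list) \<Rightarrow> bool" where
  "listings H sl rl \<longleftrightarrow>
     (\<forall>h\<in>hyperedges H. mset (sl h) = source H h \<and> mset (rl h) = target H h)"

datatype ('v, 'e) lpa_gen = Vert 'v | Edge 'e nat nat | Ghost 'e nat nat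

definition edge_indices :: "('v, 'e) hypergraph \<Rightarrow> ('e \<times> nat \<times> nat) set" where
  "edge_indices H =
     {(h, i, j). h \<in> hyperedges H \<and> i \<in> {1..size (source H h)} \<and> j \<in> {1..size (target H h)}}"

definition lpa_gens :: "('v, 'e) hypergraph \<Rightarrow> ('v, 'e) lpa_gen set" where
  "lpa_gens H = {Vert v | v. v \<in> verts H}
     \<union> {Edge h i j | h i j. (h, i, j) \<in> edge_indices H}
     \<union> {Ghost h i j | h i j. (h, i, j) \<in> edge_indices H}"

text \<open>
  A relation \<open>a = b\<close> is encoded as the relator \<open>a - b\<close>. Indices run from 1, whereas list positions
  are counted from 0.
\<close>

definition lpa_relators ::
    "('v, 'e) hypergraph \<Rightarrow> ('e \<Rightarrow> 'v list) \<Rightarrow> ('e \<Rightarrow> 'v list)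
      \<Rightarrow> (('v, 'e) lpa_gen list \<Rightarrow>\<^sub>0 'k::field) set" where
  "lpa_relators H sl rl =
    (let V = (\<lambda>v. letter (Vert v));
         E = (\<lambda>h i j. letter (Edge h i j));
         E' = (\<lambda>h i j. letter (Ghost h i j));
         S = (\<lambda>h i. letter (Vert (sl h ! (i - 1))));
         T = (\<lambda>h j. letter (Vert (rl h ! (j - 1))))
     in {V u * V v - (if u = v then V u else 0) | u v. u \<in> verts H \<and> v \<in> verts H}
      \<union> {S h i * E h i j - E h i j | h i j. (h, i, j) \<in> edge_indices H}
      \<union> {E h i j * T h j - E h i j | h i j. (h, i, j) \<in> edge_indices H}
      \<union> {T h j * E' h i j - E' h i j | h i j. (h, i, j) \<in> edge_indices H}
      \<union> {E' h i j * S h i - E' h i j | h i j. (h, i, j) \<in> edge_indices H}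
      \<union> {(\<Sum>k = 1..size (target H h). E h i k * E' h j k) - (if i = j then S h i else 0) | h i j.
           h \<in> hyperedges H \<and> i \<in> {1..size (source H h)} \<and> j \<in> {1..size (source H h)}}
      \<union> {(\<Sum>k = 1..size (source H h). E' h k i * E h k j) - (if i = j then T h i else 0) | h i j.
           h \<in> hyperedges H \<and> i \<in> {1..size (target H h)} \<and> j \<in> {1..size (target H h)}})"

definition leavitt_path_algebra ::
    "('v, 'e) hypergraph \<Rightarrow> ('e \<Rightarrow> 'v list) \<Rightarrow> ('e \<Rightarrow> 'v list)
      \<Rightarrow> ('k::field, (('v, 'e) lpa_gen list \<Rightarrow>\<^sub>0 'k) set) module" where
  "leavitt_path_algebra H sl rl = presented_algebra (lpa_gens H) (lpa_relators H sl rl)"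

definition lpa_generator ::
    "('v, 'e) hypergraph \<Rightarrow> ('e \<Rightarrow> 'v list) \<Rightarrow> ('e \<Rightarrow> 'v list)
      \<Rightarrow> ('v, 'e) lpa_gen \<Rightarrow> (('v, 'e) lpa_gen list \<Rightarrow>\<^sub>0 'k::field) set" where
  "lpa_generator H sl rl x = residue_class (lpa_gens H) (lpa_relators H sl rl) (letter x)"

end

theory Submission
  imports Defs
begin

text \<open>
  Every generator \<open>x\<close> satisfies \<open>u x = x = x v\<close> for two vertices \<open>u, v\<close>, so the sum of the vertices
  occurring at the ends of the words of an element is a unit for that element. Reversing words
  while exchanging \<open>h\<^sub>i\<^sub>j\<close> and \<open>h\<^sub>i\<^sub>j\<^sup>*\<close> is an involution of the free algebra that permutes the relators.
  All relators are homogeneous, so the ideal contains the homogeneous components of its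
  elements and the grading of the free algebra descends to the quotient.
\<close>

section \<open>The free algebra\<close>

text \<open>The quotient is formed inside a larger algebra that has a unit, the empty word, which
  \<open>free_algebra\<close> leaves out. The ideal absorbs products with combinations of nonempty
  words only, and the empty word, which appears when a letter is split off a word of length one, has
  to be treated as a scalar. For the same reason \<open>A\<close> serves only as an abelian group
  until a unit has been found. Extra vertices in a sum do no harm: distinct vertices are orthogonal,
  so \<open>v x\<close> vanishes in the quotient unless \<open>v\<close> is the left end of
  \<open>x\<close>, and a finite sum of vertices containing that end fixes \<open>x\<close>. Hence
  finitely many elements can share one local unit. The degree sees only the source index. All
  products in a relator of type (iii) have degree \<alpha>_i - \<alpha>_j, and the delta term is
  zero unless i = j; in type (iv) the k-th product has degree -\<alpha>_k + \<alpha>_k = 0.\<close>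

lemma poly_mapping_single_induct [case_names zero single add]:
  fixes p :: "'a \<Rightarrow>\<^sub>0 'k::comm_monoid_add"
  assumes "P 0"
    and "\<And>w c. w \<in> Poly_Mapping.keys p \<Longrightarrow> P (Poly_Mapping.single w c)"
    and "\<And>a b. P a \<Longrightarrow> P b \<Longrightarrow> P (a + b)"
  shows "P p"
proof -
  \<comment> \<open>Only words in the support of \<open>p\<close> occur here. This lets the
    \<open>single\<close> case use what is known about the words of \<open>p\<close>, for instance
    that they are nonempty words over \<open>B\<close>.\<close>
  have expansion: "p = (\<Sum>w\<in>Poly_Mapping.keys p. Poly_Mapping.single w (Poly_Mapping.lookup p w))"
    by (intro poly_mapping_eqI)
      (auto simp: lookup_sum lookup_single when_def sum.delta' in_keys_iff)
  have "P (\<Sum>w\<in>W. Poly_Mapping.single w (Poly_Mapping.lookup p w))"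
    if "finite W" "W \<subseteq> Poly_Mapping.keys p" for W
    using that by (induction W rule: finite_induct) (auto intro: assms)
  from this[OF finite_keys subset_refl] show ?thesis
    using expansion by simp
qed

lemma free_algebra_zero: "0 \<in> free_algebra B"
  by (simp add: free_algebra_def)

lemma free_algebra_single: "w \<noteq> [] \<Longrightarrow> set w \<subseteq> B \<Longrightarrow> Poly_Mapping.single w c \<in> free_algebra B"
  by (simp add: free_algebra_def)

lemma free_algebra_letter: "x \<in> B \<Longrightarrow> letter x \<in> free_algebra B"
  by (simp add: letter_def free_algebra_single)

lemma free_algebra_add:
  "p \<in> free_algebra B \<Longrightarrow> q \<in> free_algebra B \<Longrightarrow> p + q \<in> free_algebra B"
  using Poly_Mapping.keys_add[of p q] by (fastforce simp: free_algebra_def)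

lemma free_algebra_mult:
  "p \<in> free_algebra B \<Longrightarrow> q \<in> free_algebra B \<Longrightarrow> p * q \<in> free_algebra B"
  using keys_mult[of p q] unfolding free_algebra_def plus_list_def by fastforce

lemma free_algebra_scale: "p \<in> free_algebra B \<Longrightarrow> scale c p \<in> free_algebra B"
  using keys_mult[of "Poly_Mapping.single [] c" p]
  unfolding free_algebra_def scale_def plus_list_def by (auto split: if_splits)

lemma single_Nil_one: "Poly_Mapping.single [] 1 = 1"
  by (metis single_one zero_list_def)

text \<open>The ideal has no rule for negatives; the scalar -1 supplies them.\<close>

lemma uminus_eq_scale: "- p = scale (- 1) p"
  by (simp add: scale_def single_uminus single_Nil_one)

lemma free_algebra_uminus: "p \<in> free_algebra B \<Longrightarrow> - p \<in> free_algebra B"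
  by (simp add: uminus_eq_scale free_algebra_scale)

lemma free_algebra_diff:
  "p \<in> free_algebra B \<Longrightarrow> q \<in> free_algebra B \<Longrightarrow> p - q \<in> free_algebra B"
  using free_algebra_add free_algebra_uminus by (metis add_uminus_conv_diff)

lemma free_algebra_sum:
  "(\<And>i. i \<in> I \<Longrightarrow> p i \<in> free_algebra B) \<Longrightarrow> (\<Sum>i\<in>I. p i) \<in> free_algebra B"
  by (induction I rule: infinite_finite_induct) (auto intro: free_algebra_zero free_algebra_add)

text \<open>The empty word is neutral for concatenation and the field is commutative, so
  \<open>scale\<close>, although defined by left multiplication, is central.\<close>

lemma single_Nil_commute:
  fixes p :: "'x list \<Rightarrow>\<^sub>0 'k::field"
  shows "Poly_Mapping.single [] c * p = p * Poly_Mapping.single [] c"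
  by (induction p rule: poly_mapping_single_induct)
    (simp_all add: mult_single plus_list_def mult.commute distrib_left distrib_right)

lemma scale_diff: "scale c (p - q) = scale c p - scale c q"
  by (simp add: scale_def algebra_simps)

lemma single_Cons: "Poly_Mapping.single (x # w) c = letter x * Poly_Mapping.single w c"
  by (simp add: letter_def mult_single plus_list_def)

lemma single_snoc: "Poly_Mapping.single (w @ [x]) c = Poly_Mapping.single w c * letter x"
  by (simp add: letter_def mult_single plus_list_def)

section \<open>Presented algebras\<close>

locale presentation =
  fixes B :: "'x set" and R :: "('x list \<Rightarrow>\<^sub>0 'k::field) set"
  assumes relators_free: "R \<subseteq> free_algebra B"
begin

abbreviation "I \<equiv> relation_ideal B R"
abbreviation "A \<equiv> presented_algebra B R"
abbreviation "\<pi> \<equiv> residue_class B R"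

text \<open>Needed for products of classes: every representative of the class of an element of
  \<open>free_algebra B\<close> is again in \<open>free_algebra B\<close>, hence an admissible
  multiplier for the ideal.\<close>

lemma ideal_free: "p \<in> I \<Longrightarrow> p \<in> free_algebra B"
  by (induction rule: relation_ideal.induct)
    (use relators_free in \<open>auto intro: free_algebra_zero free_algebra_add free_algebra_scale
      free_algebra_mult\<close>)

lemma ideal_uminus: "p \<in> I \<Longrightarrow> - p \<in> I"
  by (simp add: uminus_eq_scale relation_ideal.scale)

lemma ideal_diff: "p \<in> I \<Longrightarrow> q \<in> I \<Longrightarrow> p - q \<in> I"
  using relation_ideal.add ideal_uminus by (metis add_uminus_conv_diff)

lemma ideal_sum: "(\<And>i. i \<in> J \<Longrightarrow> p i \<in> I) \<Longrightarrow> (\<Sum>i\<in>J. p i) \<in> I"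
  by (induction J rule: infinite_finite_induct)
    (auto intro: relation_ideal.zero relation_ideal.add)

lemma ideal_trans: "p - q \<in> I \<Longrightarrow> q - r \<in> I \<Longrightarrow> p - r \<in> I"
  using relation_ideal.add[of "p - q" B R "q - r"] by simp

text \<open>Extends absorption to the empty word, where closure under \<open>scale\<close> takes the
  place of \<open>mult_left\<close> and \<open>mult_right\<close>.\<close>

lemma ideal_single_mult:
  assumes "p \<in> I" "set w \<subseteq> B"
  shows "Poly_Mapping.single w c * p \<in> I" "p * Poly_Mapping.single w c \<in> I"
proof -
  have "Poly_Mapping.single w c * p \<in> I \<and> p * Poly_Mapping.single w c \<in> I"
  proof (cases "w = []")
    case True
    then show ?thesis
      using relation_ideal.scale[OF assms(1), of c]
      by (simp add: single_Nil_commute[symmetric] flip: scale_def)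
  next
    case False
    then show ?thesis
      using assms by (simp add: relation_ideal.mult_left relation_ideal.mult_right free_algebra_single)
  qed
  then show "Poly_Mapping.single w c * p \<in> I" "p * Poly_Mapping.single w c \<in> I" by auto
qed

section \<open>Residue classes and the operations on them\<close>

lemma residue_class_eq_iff: "\<pi> p = \<pi> q \<longleftrightarrow> p - q \<in> I"
proof
  assume "\<pi> p = \<pi> q"
  moreover have "p \<in> \<pi> p"
    by (simp add: residue_class_def relation_ideal.zero)
  ultimately show "p - q \<in> I"
    by (simp add: residue_class_def)
next
  assume pq: "p - q \<in> I"
  then have "q - p \<in> I"
    using ideal_uminus[OF pq] by simp
  with pq show "\<pi> p = \<pi> q"
    unfolding residue_class_def using ideal_trans[of _ p q] ideal_trans[of _ q p] by blast
qed

lemma mem_residue_class_iff: "p \<in> \<pi> q \<longleftrightarrow> p - q \<in> I"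
  by (simp add: residue_class_def)

lemma residue_class_self: "p \<in> \<pi> p"
  by (simp add: mem_residue_class_iff relation_ideal.zero)

text \<open>The operations of \<open>presented_algebra\<close> are unions over all representatives.
  Independence of the representative collapses such a union to a single class.\<close>

lemma UN_residue_class:
  assumes "\<And>a. a - p \<in> I \<Longrightarrow> F a = F p"
  shows "(\<Union>a\<in>\<pi> p. F a) = F p"
  using assms residue_class_self[of p] unfolding mem_residue_class_iff[symmetric] by blast

lemma UN_residue_class2:
  assumes "\<And>a b. a - p \<in> I \<Longrightarrow> b - q \<in> I \<Longrightarrow> F a b = F p q"
  shows "(\<Union>a\<in>\<pi> p. \<Union>b\<in>\<pi> q. F a b) = F p q"
  using assms residue_class_self[of p] residue_class_self[of q]
  unfolding mem_residue_class_iff[symmetric] by blast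

lemma carrier_presented: "carrier A = \<pi> ` free_algebra B"
  by (simp add: presented_algebra_def)

lemma residue_class_closed: "p \<in> free_algebra B \<Longrightarrow> \<pi> p \<in> carrier A"
  by (simp add: carrier_presented)

lemma zero_presented: "\<zero>\<^bsub>A\<^esub> = \<pi> 0"
  by (simp add: presented_algebra_def)

lemma add_presented: "\<pi> p \<oplus>\<^bsub>A\<^esub> \<pi> q = \<pi> (p + q)"
proof -
  have "\<pi> (a + b) = \<pi> (p + q)" if "a - p \<in> I" "b - q \<in> I" for a b
    using relation_ideal.add[OF that] by (simp add: residue_class_eq_iff algebra_simps)
  then show ?thesis
    unfolding presented_algebra_def by simp (rule UN_residue_class2)
qed

lemma mult_presented:
  assumes "p \<in> free_algebra B" "q \<in> free_algebra B"
  shows "\<pi> p \<otimes>\<^bsub>A\<^esub> \<pi> q = \<pi> (p * q)"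
proof -
  have "\<pi> (a * b) = \<pi> (p * q)" if "a - p \<in> I" "b - q \<in> I" for a b
  proof -
    \<comment> \<open>Right multiplication by \<open>b\<close> preserves the ideal only for
      \<open>b\<close> in \<open>free_algebra B\<close>. The goal then follows from
      \<open>a * b - p * q = (a - p) * b + p * (b - q)\<close>.\<close>
    have "b \<in> free_algebra B"
      using free_algebra_add[OF ideal_free[OF that(2)] assms(2)] by simp
    then have "(a - p) * b + p * (b - q) \<in> I"
      using that assms by (intro relation_ideal.add relation_ideal.mult_left relation_ideal.mult_right)
    then show ?thesis by (simp add: residue_class_eq_iff algebra_simps)
  qed
  then show ?thesis
    unfolding presented_algebra_def by simp (rule UN_residue_class2)
qed

lemma smult_presented: "c \<odot>\<^bsub>A\<^esub> \<pi> p = \<pi> (scale c p)"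
proof -
  have "\<pi> (scale c a) = \<pi> (scale c p)" if "a - p \<in> I" for a
    using relation_ideal.scale[OF that, of c]
    by (simp add: residue_class_eq_iff scale_diff)
  then show ?thesis
    by (simp add: presented_algebra_def UN_residue_class)
qed

section \<open>Additive group and unital ring structure\<close>

lemma abelian_group_presented: "abelian_group A"
proof (rule abelian_groupI)
  fix x assume "x \<in> carrier A"
  then obtain p where p: "p \<in> free_algebra B" "x = \<pi> p"
    by (auto simp: carrier_presented)
  then have "\<pi> (- p) \<in> carrier A" "\<pi> (- p) \<oplus>\<^bsub>A\<^esub> x = \<zero>\<^bsub>A\<^esub>"
    by (simp_all add: residue_class_closed free_algebra_uminus add_presented zero_presented)
  then show "\<exists>y\<in>carrier A. y \<oplus>\<^bsub>A\<^esub> x = \<zero>\<^bsub>A\<^esub>" by blast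
next
  fix x y z assume "x \<in> carrier A" "y \<in> carrier A" "z \<in> carrier A"
  then obtain p q r where "p \<in> free_algebra B" "q \<in> free_algebra B" "r \<in> free_algebra B"
    "x = \<pi> p" "y = \<pi> q" "z = \<pi> r"
    by (auto simp: carrier_presented)
  then show "x \<oplus>\<^bsub>A\<^esub> y \<in> carrier A" "x \<oplus>\<^bsub>A\<^esub> y = y \<oplus>\<^bsub>A\<^esub> x" "\<zero>\<^bsub>A\<^esub> \<oplus>\<^bsub>A\<^esub> x = x"
    "(x \<oplus>\<^bsub>A\<^esub> y) \<oplus>\<^bsub>A\<^esub> z = x \<oplus>\<^bsub>A\<^esub> (y \<oplus>\<^bsub>A\<^esub> z)"
    by (simp_all add: add_presented zero_presented residue_class_closed free_algebra_add
        add_ac)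
qed (simp add: zero_presented residue_class_closed free_algebra_zero)

text \<open>The field \<open>one\<close> of \<open>A\<close> is unspecified, so only the additive
  structure is interpreted; it provides \<open>finsum\<close> and additive inverses.\<close>

sublocale abelian_group A
  by (rule abelian_group_presented)

lemma a_inv_presented:
  assumes "p \<in> free_algebra B"
  shows "\<ominus>\<^bsub>A\<^esub> \<pi> p = \<pi> (- p)"
  using assms
  by (intro minus_equality)
    (simp_all add: add_presented zero_presented residue_class_closed free_algebra_uminus)

lemma finsum_presented:
  assumes "finite J" "\<And>i. i \<in> J \<Longrightarrow> p i \<in> free_algebra B"
  shows "(\<Oplus>\<^bsub>A\<^esub>i\<in>J. \<pi> (p i)) = \<pi> (\<Sum>i\<in>J. p i)"
  using assms
  by (induction J rule: finite_induct)
    (auto simp: zero_presented finsum_insert residue_class_closed add_presented)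

lemma ring_presented:
  assumes "e \<in> free_algebra B"
    and "\<And>p. p \<in> free_algebra B \<Longrightarrow> e * p - p \<in> I"
    and "\<And>p. p \<in> free_algebra B \<Longrightarrow> p * e - p \<in> I"
  shows "ring (A\<lparr>one := \<pi> e\<rparr>)"
proof (rule ringI)
  let ?A = "A\<lparr>one := \<pi> e\<rparr>"
  \<comment> \<open>The additive axioms read only the carrier, the addition and the zero, which the
    update of \<open>one\<close> leaves alone.\<close>
  show "abelian_group ?A"
    using abelian_group_presented
    by (simp add: abelian_group_def abelian_group_axioms_def abelian_monoid_def)
  show "Group.monoid ?A"
  proof (rule monoidI)
    fix x y z assume "x \<in> carrier ?A" "y \<in> carrier ?A" "z \<in> carrier ?A"
    then obtain p q r where "p \<in> free_algebra B" "q \<in> free_algebra B" "r \<in> free_algebra B"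
      "x = \<pi> p" "y = \<pi> q" "z = \<pi> r"
      by (auto simp: carrier_presented)
    then show "x \<otimes>\<^bsub>?A\<^esub> y \<in> carrier ?A"
      "(x \<otimes>\<^bsub>?A\<^esub> y) \<otimes>\<^bsub>?A\<^esub> z = x \<otimes>\<^bsub>?A\<^esub> (y \<otimes>\<^bsub>?A\<^esub> z)"
      "\<one>\<^bsub>?A\<^esub> \<otimes>\<^bsub>?A\<^esub> x = x" "x \<otimes>\<^bsub>?A\<^esub> \<one>\<^bsub>?A\<^esub> = x"
      using assms
      by (simp_all add: mult_presented free_algebra_mult residue_class_closed mult.assoc
          residue_class_eq_iff)
  qed (simp add: assms residue_class_closed)
  fix x y z assume "x \<in> carrier ?A" "y \<in> carrier ?A" "z \<in> carrier ?A"
  then obtain p q r where *: "p \<in> free_algebra B" "q \<in> free_algebra B" "r \<in> free_algebra B"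
    "x = \<pi> p" "y = \<pi> q" "z = \<pi> r"
    by (auto simp: carrier_presented)
  then show "(x \<oplus>\<^bsub>?A\<^esub> y) \<otimes>\<^bsub>?A\<^esub> z = x \<otimes>\<^bsub>?A\<^esub> z \<oplus>\<^bsub>?A\<^esub> y \<otimes>\<^bsub>?A\<^esub> z"
    "z \<otimes>\<^bsub>?A\<^esub> (x \<oplus>\<^bsub>?A\<^esub> y) = z \<otimes>\<^bsub>?A\<^esub> x \<oplus>\<^bsub>?A\<^esub> z \<otimes>\<^bsub>?A\<^esub> y"
    by (simp_all add: add_presented mult_presented free_algebra_add distrib_left distrib_right)
qed

text \<open>By linearity a single word \<open>x # w\<close> suffices, and there
  \<open>e * x * w - x * w = (e * x - x) * w\<close>: only the first letter is tested, and the ideal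
  absorbs the rest.\<close>

lemma left_unit:
  assumes "p \<in> free_algebra B"
    and "\<And>w. w \<in> Poly_Mapping.keys p \<Longrightarrow> e * letter (hd w) - letter (hd w) \<in> I"
  shows "e * p - p \<in> I"
proof (induction p rule: poly_mapping_single_induct)
  case zero
  show ?case by (simp add: relation_ideal.zero)
next
  case (single w c)
  then have w: "w \<noteq> []" "set w \<subseteq> B"
    using assms(1) by (auto simp: free_algebra_def)
  define a where "a = e * letter (hd w) - letter (hd w)"
  \<comment> \<open>The tail may be empty, so \<open>mult_right\<close> alone would not do.\<close>
  have "a * Poly_Mapping.single (tl w) c \<in> I"
    using assms(2)[OF single] w by (intro ideal_single_mult) (auto simp: a_def dest: list.set_sel(2))
  moreover have "Poly_Mapping.single w c = letter (hd w) * Poly_Mapping.single (tl w) c"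
    using w by (simp flip: single_Cons)
  ultimately show ?case
    by (simp add: a_def left_diff_distrib mult.assoc)
next
  case (add p q)
  from relation_ideal.add[OF this] show ?case
    by (simp add: algebra_simps)
qed

lemma right_unit:
  assumes "p \<in> free_algebra B"
    and "\<And>w. w \<in> Poly_Mapping.keys p \<Longrightarrow> letter (last w) * e - letter (last w) \<in> I"
  shows "p * e - p \<in> I"
proof (induction p rule: poly_mapping_single_induct)
  case zero
  show ?case by (simp add: relation_ideal.zero)
next
  case (single w c)
  then have w: "w \<noteq> []" "set w \<subseteq> B"
    using assms(1) by (auto simp: free_algebra_def)
  define a where "a = letter (last w) * e - letter (last w)"
  have "Poly_Mapping.single (butlast w) c * a \<in> I"
    using assms(2)[OF single] w by (intro ideal_single_mult) (auto simp: a_def dest: in_set_butlastD)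
  moreover have "Poly_Mapping.single w c = Poly_Mapping.single (butlast w) c * letter (last w)"
    using w by (simp flip: single_snoc)
  ultimately show ?case
    by (simp add: a_def right_diff_distrib mult.assoc)
next
  case (add p q)
  from relation_ideal.add[OF this] show ?case
    by (simp add: algebra_simps)
qed

end

section \<open>Involutions of presented algebras\<close>

text \<open>The linear extension of \<open>w \<mapsto> rev (map \<phi> w)\<close>. Precomposition
  with this word map, as done by \<open>map_key\<close>, agrees with pushing words forward because
  the map is its own inverse when \<phi> is.\<close>

definition reversal :: "('x \<Rightarrow> 'x) \<Rightarrow> ('x list \<Rightarrow>\<^sub>0 'k::field) \<Rightarrow> ('x list \<Rightarrow>\<^sub>0 'k)" where
  "reversal \<phi> = Poly_Mapping.map_key (\<lambda>w. rev (map \<phi> w))"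

context
  fixes \<phi> :: "'x \<Rightarrow> 'x"
  assumes \<phi>_involutive: "\<phi> (\<phi> x) = x"
begin

lemma rev_map_involutive: "rev (map \<phi> (rev (map \<phi> w))) = w"
  by (simp add: rev_map \<phi>_involutive comp_def)

text \<open>Injectivity is what lets \<open>map_key\<close> be evaluated as precomposition with the
  word map.\<close>

lemma inj_rev_map: "inj (\<lambda>w. rev (map \<phi> w))"
  by (metis injI rev_map_involutive)

lemma lookup_reversal: "Poly_Mapping.lookup (reversal \<phi> p) w = Poly_Mapping.lookup p (rev (map \<phi> w))"
  by (simp add: reversal_def map_key.rep_eq inj_rev_map)

lemma reversal_zero: "reversal \<phi> 0 = 0"
  by (intro poly_mapping_eqI) (simp add: lookup_reversal)

lemma reversal_add: "reversal \<phi> (p + q) = reversal \<phi> p + reversal \<phi> q"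
  by (intro poly_mapping_eqI) (simp add: lookup_reversal lookup_add)

lemma reversal_diff: "reversal \<phi> (p - q) = reversal \<phi> p - reversal \<phi> q"
  by (intro poly_mapping_eqI) (simp add: lookup_reversal lookup_minus)

lemma reversal_sum: "reversal \<phi> (\<Sum>i\<in>J. p i) = (\<Sum>i\<in>J. reversal \<phi> (p i))"
  by (induction J rule: infinite_finite_induct) (simp_all add: reversal_zero reversal_add)

lemma reversal_single: "reversal \<phi> (Poly_Mapping.single w c) = Poly_Mapping.single (rev (map \<phi> w)) c"
  by (intro poly_mapping_eqI) (auto simp: lookup_reversal lookup_single when_def rev_map_involutive)

lemma reversal_letter: "reversal \<phi> (letter x) = letter (\<phi> x)"
  by (simp add: letter_def reversal_single)

text \<open>Both sides are bilinear, so a nested induction reduces the claim to two words, where it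
  says that \<open>rev\<close> reverses concatenation; the coefficients commute.\<close>

lemma reversal_mult: "reversal \<phi> (p * q) = reversal \<phi> q * reversal \<phi> p"
proof (induction p rule: poly_mapping_single_induct)
  case (single w c)
  show ?case
    by (induction q rule: poly_mapping_single_induct)
      (simp_all add: reversal_zero reversal_add reversal_single mult_single plus_list_def
        mult.commute[of c] distrib_left distrib_right)
qed (simp_all add: reversal_zero reversal_add distrib_left distrib_right)

lemma reversal_scale: "reversal \<phi> (scale c p) = scale c (reversal \<phi> p)"
  by (simp add: scale_def reversal_mult reversal_single single_Nil_commute)

lemma reversal_involutive: "reversal \<phi> (reversal \<phi> p) = p"
  by (intro poly_mapping_eqI) (simp only: lookup_reversal rev_map_involutive)

lemma free_algebra_reversal:
  assumes "\<phi> ` B \<subseteq> B" "p \<in> free_algebra B"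
  shows "reversal \<phi> p \<in> free_algebra B"
  unfolding free_algebra_def
proof (intro CollectI ballI)
  fix w assume "w \<in> Poly_Mapping.keys (reversal \<phi> p)"
  then have "rev (map \<phi> w) \<in> Poly_Mapping.keys p"
    by (simp add: in_keys_iff lookup_reversal)
  then have "rev (map \<phi> w) \<noteq> [] \<and> set (rev (map \<phi> w)) \<subseteq> B"
    using assms(2) unfolding free_algebra_def by blast
  then have w: "w \<noteq> []" "\<phi> ` set w \<subseteq> B" by simp_all
  \<comment> \<open>The inclusion of \<phi>(B) in B is used backwards: x is the image of \<phi>(x),
    which lies in B.\<close>
  have "x \<in> B" if "x \<in> set w" for x
    using w(2) assms(1) that \<phi>_involutive[of x] by (metis imageI subsetD)
  with w(1) show "w \<noteq> [] \<and> set w \<subseteq> B" by blast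
qed

end

lemma (in presentation) linear_involution_presented:
  assumes involutive: "\<And>x. \<phi> (\<phi> x) = x" and gens: "\<phi> ` B \<subseteq> B"
    and relators: "\<And>p. p \<in> R \<Longrightarrow> reversal \<phi> p \<in> I"
  obtains f where "linear_involution A f" "\<And>p. f (\<pi> p) = \<pi> (reversal \<phi> p)"
proof -
  note reversal = reversal_zero[OF involutive] reversal_add[OF involutive]
    reversal_scale[OF involutive] reversal_mult[OF involutive]
    free_algebra_reversal[OF involutive gens]
  \<comment> \<open>Reversal exchanges \<open>mult_left\<close> and \<open>mult_right\<close> and
    respects the remaining closure rules, so a hypothesis on the relators alone is enough.\<close>
  have ideal: "reversal \<phi> p \<in> I" if "p \<in> I" for p
    using that
  proof (induction rule: relation_ideal.induct)
    case (mult_left p a)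
    then show ?case by (simp add: reversal relation_ideal.mult_right)
  next
    case (mult_right p a)
    then show ?case by (simp add: reversal relation_ideal.mult_left)
  qed (simp_all add: relators reversal relation_ideal.zero relation_ideal.add relation_ideal.scale)
  \<comment> \<open>A union over representatives gives a function on classes without a choice; by
    \<open>ideal\<close> all representatives yield the same class.\<close>
  define f where "f P = (\<Union>p\<in>P. \<pi> (reversal \<phi> p))" for P
  have f: "f (\<pi> p) = \<pi> (reversal \<phi> p)" for p
    unfolding f_def
    by (rule UN_residue_class)
      (simp add: residue_class_eq_iff ideal flip: reversal_diff[OF involutive])
  have "linear_involution A f"
    unfolding linear_involution_def carrier_presented
    by (simp add: Pi_iff f add_presented mult_presented smult_presented free_algebra_add
        free_algebra_mult reversal reversal_involutive[OF involutive])
  with f that show ?thesis by blast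
qed

section \<open>Gradings of presented algebras\<close>

definition word_degree :: "('x \<Rightarrow> 'g::comm_monoid_add) \<Rightarrow> 'x list \<Rightarrow> 'g" where
  "word_degree d w = sum_list (map d w)"

definition homogeneous :: "('x \<Rightarrow> 'g::comm_monoid_add) \<Rightarrow> 'g \<Rightarrow> ('x list \<Rightarrow>\<^sub>0 'k::field) set" where
  "homogeneous d g = {p. \<forall>w \<in> Poly_Mapping.keys p. word_degree d w = g}"

definition component ::
    "('x \<Rightarrow> 'g::comm_monoid_add) \<Rightarrow> 'g \<Rightarrow> ('x list \<Rightarrow>\<^sub>0 'k::field) \<Rightarrow> ('x list \<Rightarrow>\<^sub>0 'k)" where
  "component d g = Poly_Mapping.mapp (\<lambda>w c. c when word_degree d w = g)"

lemma word_degree_append: "word_degree d (u @ w) = word_degree d u + word_degree d w"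
  by (simp add: word_degree_def)

lemma lookup_component:
  "Poly_Mapping.lookup (component d g p) w = (Poly_Mapping.lookup p w when word_degree d w = g)"
  by (simp add: component_def lookup_mapp when_def in_keys_iff)

lemma component_zero: "component d g 0 = 0"
  by (intro poly_mapping_eqI) (simp add: lookup_component)

lemma component_add: "component d g (p + q) = component d g p + component d g q"
  by (intro poly_mapping_eqI) (simp add: lookup_component lookup_add when_add_distrib)

lemma component_diff: "component d g (p - q) = component d g p - component d g q"
  by (intro poly_mapping_eqI) (simp add: lookup_component lookup_minus when_diff_distrib)

lemma component_sum: "component d g (\<Sum>i\<in>J. p i) = (\<Sum>i\<in>J. component d g (p i))"
  by (induction J rule: infinite_finite_induct) (simp_all add: component_zero component_add)

lemma component_homogeneous:
  assumes "p \<in> homogeneous d h"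
  shows "component d g p = (if g = h then p else 0)"
  using assms
  by (intro poly_mapping_eqI) (auto simp: lookup_component homogeneous_def in_keys_iff when_def)

lemma homogeneous_component: "component d g p \<in> homogeneous d g"
  by (auto simp: homogeneous_def in_keys_iff lookup_component)

lemma free_algebra_component: "p \<in> free_algebra B \<Longrightarrow> component d g p \<in> free_algebra B"
  by (auto simp: free_algebra_def in_keys_iff lookup_component)

lemma sum_components:
  assumes "finite T" "word_degree d ` Poly_Mapping.keys p \<subseteq> T"
  shows "(\<Sum>g\<in>T. component d g p) = p"
proof (rule poly_mapping_eqI)
  fix w
  show "Poly_Mapping.lookup (\<Sum>g\<in>T. component d g p) w = Poly_Mapping.lookup p w"
  proof (cases "w \<in> Poly_Mapping.keys p")
    case True
    then have "word_degree d w \<in> T" using assms(2) by blast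
    then show ?thesis
      by (simp add: lookup_sum lookup_component when_def assms(1))
  qed (simp add: lookup_sum lookup_component in_keys_iff)
qed

text \<open>Multiplying by a word shifts degrees by the degree of that word. Undoing the shift needs
  subtraction, hence degrees in an abelian group.\<close>

lemma component_single_mult:
  fixes d :: "'x \<Rightarrow> 'g::ab_group_add" and p :: "'x list \<Rightarrow>\<^sub>0 'k::field"
  shows "component d g (Poly_Mapping.single w c * p)
    = Poly_Mapping.single w c * component d (g - word_degree d w) p"
    "component d g (p * Poly_Mapping.single w c)
    = component d (g - word_degree d w) p * Poly_Mapping.single w c"
proof -
  have single: "component d h (Poly_Mapping.single v b)
    = Poly_Mapping.single v (b when word_degree d v = h)" for h v and b :: 'k
    by (intro poly_mapping_eqI) (simp add: lookup_component lookup_single when_def)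
  show "component d g (Poly_Mapping.single w c * p)
    = Poly_Mapping.single w c * component d (g - word_degree d w) p"
    by (induction p rule: poly_mapping_single_induct)
      (simp_all add: component_zero component_add distrib_left single mult_single plus_list_def
        word_degree_append when_def algebra_simps)
  show "component d g (p * Poly_Mapping.single w c)
    = component d (g - word_degree d w) p * Poly_Mapping.single w c"
    by (induction p rule: poly_mapping_single_induct)
      (simp_all add: component_zero component_add distrib_right single mult_single plus_list_def
        word_degree_append when_def algebra_simps)
qed

lemma homogeneous_add:
  "p \<in> homogeneous d g \<Longrightarrow> q \<in> homogeneous d g \<Longrightarrow> p + q \<in> homogeneous d g"
  using Poly_Mapping.keys_add[of p q] unfolding homogeneous_def by blast

lemma homogeneous_mult:
  "p \<in> homogeneous d g \<Longrightarrow> q \<in> homogeneous d h \<Longrightarrow> p * q \<in> homogeneous d (g + h)"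
  using keys_mult[of p q] unfolding homogeneous_def
  by (fastforce simp: plus_list_def word_degree_append)

lemma homogeneous_scale: "p \<in> homogeneous d g \<Longrightarrow> scale c p \<in> homogeneous d g"
  using homogeneous_mult[of "Poly_Mapping.single [] c" d 0 p g]
  by (simp add: scale_def homogeneous_def word_degree_def)

lemma homogeneous_uminus: "p \<in> homogeneous d g \<Longrightarrow> - p \<in> homogeneous d g"
  by (simp add: uminus_eq_scale homogeneous_scale)

lemma homogeneous_diff:
  "p \<in> homogeneous d g \<Longrightarrow> q \<in> homogeneous d g \<Longrightarrow> p - q \<in> homogeneous d g"
  using homogeneous_add homogeneous_uminus by (metis add_uminus_conv_diff)

lemma homogeneous_zero: "0 \<in> homogeneous d g"
  by (simp add: homogeneous_def)

lemma homogeneous_sum: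
  "(\<And>i. i \<in> J \<Longrightarrow> p i \<in> homogeneous d g) \<Longrightarrow> (\<Sum>i\<in>J. p i) \<in> homogeneous d g"
  by (induction J rule: infinite_finite_induct) (auto intro: homogeneous_zero homogeneous_add)

lemma homogeneous_letter: "letter x \<in> homogeneous d (d x)"
  by (simp add: homogeneous_def letter_def word_degree_def)

text \<open>Degrees range over all finitely supported integer families on the type;
  \<open>degree_carrier\<close> confines those of words over \<open>B\<close> to the subgroup
  \<open>free_Abelian_group S\<close> that indexes the grading.\<close>

locale graded_presentation = presentation B R
  for B :: "'x set" and R :: "('x list \<Rightarrow>\<^sub>0 'k::field) set" +
  fixes S :: "'i set" and d :: "'x \<Rightarrow> 'i \<Rightarrow>\<^sub>0 int"
  assumes degree_carrier: "x \<in> B \<Longrightarrow> Poly_Mapping.keys (d x) \<subseteq> S"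
    and relators_homogeneous: "p \<in> R \<Longrightarrow> \<exists>g. p \<in> homogeneous d g"
begin

lemma word_degree_carrier: "set w \<subseteq> B \<Longrightarrow> Poly_Mapping.keys (word_degree d w) \<subseteq> S"
proof (induction w)
  case (Cons x w)
  then show ?case
    using degree_carrier[of x] Poly_Mapping.keys_add[of "d x" "word_degree d w"]
    by (auto simp: word_degree_def)
qed (simp add: word_degree_def)

text \<open>Each word of \<open>a\<close> shifts the degree by its own amount, so one component of
  the product draws on components of \<open>p\<close> in several degrees; hence the hypothesis for
  all \<open>g\<close>.\<close>

lemma ideal_mult_component:
  assumes "a \<in> free_algebra B" "\<And>g. component d g p \<in> I"
  shows "component d g (a * p) \<in> I" "component d g (p * a) \<in> I"
proof -
  have "component d g (a * p) \<in> I \<and> component d g (p * a) \<in> I"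
  proof (induction a rule: poly_mapping_single_induct)
    case (single w c)
    then have "set w \<subseteq> B" using assms(1) by (auto simp: free_algebra_def)
    then show ?case
      by (simp add: component_single_mult ideal_single_mult assms(2))
  qed (simp_all add: component_zero component_add relation_ideal.zero relation_ideal.add
      distrib_left distrib_right)
  then show "component d g (a * p) \<in> I" "component d g (p * a) \<in> I" by auto
qed

lemma ideal_component: "p \<in> I \<Longrightarrow> component d g p \<in> I"
\<comment> \<open>The degree is generalised because products evaluate the components of
  \<open>p\<close> at shifted degrees.\<close>
proof (induction arbitrary: g rule: relation_ideal.induct)
  case (relator p)
  then obtain h where "p \<in> homogeneous d h"
    using relators_homogeneous by blast
  then show ?case
    using relator by (simp add: component_homogeneous relation_ideal.zero relation_ideal.relator)
next
  \<comment> \<open>A scalar is a monomial on the empty word, whose degree is 0, so no shift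
    occurs.\<close>
  case (scale p c)
  then show ?case
    using ideal_single_mult(1)[of "component d g p" "[]" c] component_single_mult(1)[of d g "[]" c p]
    by (simp add: scale_def word_degree_def)
qed (simp_all add: component_zero component_add relation_ideal.zero relation_ideal.add
    ideal_mult_component)

section \<open>Direct sum decomposition of the quotient\<close>

definition part :: "('i \<Rightarrow>\<^sub>0 int) \<Rightarrow> ('x list \<Rightarrow>\<^sub>0 'k) set set" where
  "part g = \<pi> ` (free_algebra B \<inter> homogeneous d g)"

lemma submodule_part: "submodule (part g) (ring_of_type_algebra :: 'k ring) A"
proof (intro submodule.intro subgroup.intro submodule_axioms.intro)
  fix x assume "x \<in> part g"
  then obtain p where "p \<in> free_algebra B" "p \<in> homogeneous d g" "x = \<pi> p"
    by (auto simp: part_def)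
  then show "inv\<^bsub>add_monoid A\<^esub> x \<in> part g"
    by (auto simp: part_def a_inv_presented free_algebra_uminus homogeneous_uminus
        simp flip: a_inv_def)
next
  fix c :: 'k and x assume "x \<in> part g"
  then show "c \<odot>\<^bsub>A\<^esub> x \<in> part g"
    by (auto simp: part_def smult_presented free_algebra_scale homogeneous_scale)
next
  fix x y assume "x \<in> part g" "y \<in> part g"
  then show "x \<otimes>\<^bsub>add_monoid A\<^esub> y \<in> part g"
    by (auto simp: part_def add_presented free_algebra_add homogeneous_add)
qed (auto simp: part_def carrier_presented zero_presented free_algebra_zero homogeneous_zero)

text \<open>Homogeneous representatives of the values of \<open>f\<close> sum to \<open>p\<close>
  modulo the ideal. Taking the component of degree \<open>g\<close> isolates one of them, and the
  ideal is stable under this by \<open>ideal_component\<close>.\<close>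

lemma decomposition_unique:
  assumes f: "f \<in> (\<Pi>\<^sub>E g\<in>G. part g)" and fin: "finite {g \<in> G. f g \<noteq> \<zero>\<^bsub>A\<^esub>}"
    and sum: "\<pi> p = finsum A f {g \<in> G. f g \<noteq> \<zero>\<^bsub>A\<^esub>}"
  shows "f = (\<lambda>g\<in>G. \<pi> (component d g p))"
proof
  fix g
  define T where "T = {g \<in> G. f g \<noteq> \<zero>\<^bsub>A\<^esub>}"
  have "\<forall>g\<in>G. \<exists>a. a \<in> free_algebra B \<and> a \<in> homogeneous d g \<and> f g = \<pi> a"
    using f by (fastforce simp: part_def PiE_iff)
  then obtain a where a: "\<And>g. g \<in> G \<Longrightarrow> a g \<in> free_algebra B"
    "\<And>g. g \<in> G \<Longrightarrow> a g \<in> homogeneous d g" "\<And>g. g \<in> G \<Longrightarrow> f g = \<pi> (a g)"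
    by metis
  have TG: "T \<subseteq> G" by (auto simp: T_def)
  have "finsum A f T = (\<Oplus>\<^bsub>A\<^esub>g\<in>T. \<pi> (a g))"
    using TG a by (intro finsum_cong') (auto intro!: residue_class_closed)
  also have "\<dots> = \<pi> (\<Sum>g\<in>T. a g)"
    using fin TG a by (intro finsum_presented) (auto simp: T_def)
  finally have I: "p - (\<Sum>g\<in>T. a g) \<in> I"
    using sum by (simp add: T_def residue_class_eq_iff)
  show "f g = (\<lambda>g\<in>G. \<pi> (component d g p)) g"
  proof (cases "g \<in> G")
    case True
    have "component d g (\<Sum>h\<in>T. a h) = (\<Sum>h\<in>T. if g = h then a h else 0)"
      unfolding component_sum using TG a(2) by (intro sum.cong refl component_homogeneous) auto
    also have "\<dots> = (if g \<in> T then a g else 0)"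
      using fin by (simp add: T_def)
    finally have "\<pi> (component d g p) = \<pi> (if g \<in> T then a g else 0)"
      using ideal_component[OF I, of g] by (simp add: component_diff residue_class_eq_iff)
    \<comment> \<open>For \<open>g\<close> outside \<open>T\<close> the value \<open>f g\<close> is
      zero by the choice of \<open>T\<close>, which matches the class of 0.\<close>
    also have "\<dots> = f g"
      using True a(3) by (auto simp: T_def zero_presented)
    finally show ?thesis using True by simp
  \<comment> \<open>Outside \<open>G\<close> both functions take the default value of extensional
    functions.\<close>
  qed (use f in \<open>auto simp: PiE_iff extensional_def\<close>)
qed

lemma decomposition_exists:
  assumes p: "p \<in> free_algebra B" and G: "word_degree d ` Poly_Mapping.keys p \<subseteq> G"
  defines "f \<equiv> \<lambda>g\<in>G. \<pi> (component d g p)"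
  shows "f \<in> (\<Pi>\<^sub>E g\<in>G. part g)" "finite {g \<in> G. f g \<noteq> \<zero>\<^bsub>A\<^esub>}"
    "\<pi> p = finsum A f {g \<in> G. f g \<noteq> \<zero>\<^bsub>A\<^esub>}"
proof -
  define T where "T = {g \<in> G. f g \<noteq> \<zero>\<^bsub>A\<^esub>}"
  define U where "U = word_degree d ` Poly_Mapping.keys p"
  have U: "finite U" "U \<subseteq> G" using G by (auto simp: U_def)
  have "component d g p = 0" if "g \<notin> U" for g
    using that by (intro poly_mapping_eqI) (auto simp: lookup_component U_def in_keys_iff when_def)
  \<comment> \<open>The inclusion can be strict: a nonzero component of \<open>p\<close> may lie in
    the ideal and give the zero class. The sum over \<open>U\<close> is therefore cut down to
    \<open>T\<close> below.\<close>
  then have TU: "T \<subseteq> U"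
    by (auto simp: T_def f_def zero_presented)
  show "f \<in> (\<Pi>\<^sub>E g\<in>G. part g)"
    by (auto simp: f_def part_def p free_algebra_component homogeneous_component)
  show "finite {g \<in> G. f g \<noteq> \<zero>\<^bsub>A\<^esub>}"
    using TU U(1) finite_subset by (auto simp: T_def)
  have "\<pi> p = \<pi> (\<Sum>g\<in>U. component d g p)"
    using U(1) by (simp add: sum_components U_def)
  also have "\<dots> = (\<Oplus>\<^bsub>A\<^esub>g\<in>U. \<pi> (component d g p))"
    using U(1) p by (simp add: finsum_presented free_algebra_component)
  also have "\<dots> = finsum A f T"
  proof (rule add.finprod_mono_neutral_cong_left[OF U(1) TU, symmetric])
    show "f g = \<pi> (component d g p)" if "g \<in> T" for g
      using that by (simp add: T_def f_def)
    show "\<pi> (component d g p) = \<zero>\<^bsub>A\<^esub>" if "g \<in> U - T" for g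
      using that U(2) by (auto simp: T_def f_def)
  qed (auto simp: residue_class_closed free_algebra_component p)
  finally show "\<pi> p = finsum A f {g \<in> G. f g \<noteq> \<zero>\<^bsub>A\<^esub>}"
    by (simp add: T_def)
qed

lemma algebra_grading_part: "algebra_grading (free_Abelian_group S) A part"
  unfolding algebra_grading_def
proof (intro conjI ballI)
  let ?G = "carrier (free_Abelian_group S)"
  show "\<exists>!f. f \<in> (\<Pi>\<^sub>E g\<in>?G. part g) \<and> finite {g \<in> ?G. f g \<noteq> \<zero>\<^bsub>A\<^esub>} \<and>
      x = finsum A f {g \<in> ?G. f g \<noteq> \<zero>\<^bsub>A\<^esub>}" if x: "x \<in> carrier A" for x
  proof -
    obtain p where p: "p \<in> free_algebra B" "x = \<pi> p"
      using x by (auto simp: carrier_presented)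
    have "word_degree d ` Poly_Mapping.keys p \<subseteq> ?G"
    proof (rule image_subsetI)
      fix w assume "w \<in> Poly_Mapping.keys p"
      then have "set w \<subseteq> B" using p(1) by (auto simp: free_algebra_def)
      then show "word_degree d w \<in> ?G" using word_degree_carrier by simp
    qed
    from decomposition_exists[OF p(1) this] decomposition_unique[of _ ?G p]
    show ?thesis unfolding p(2)
      by (intro ex1I[of _ "\<lambda>g\<in>?G. \<pi> (component d g p)"]) blast+
  qed
next
  fix g h x y assume "x \<in> part g" "y \<in> part h"
  then show "x \<otimes>\<^bsub>A\<^esub> y \<in> part (g \<otimes>\<^bsub>free_Abelian_group S\<^esub> h)"
    by (auto simp: part_def mult_presented free_algebra_mult homogeneous_mult)
qed (rule submodule_part)

lemma generator_part: "x \<in> B \<Longrightarrow> \<pi> (letter x) \<in> part (d x)"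
  by (simp add: part_def free_algebra_letter homogeneous_letter)

end

section \<open>Leavitt path algebras of hypergraphs\<close>

lemma lpa_gens_simps [simp]:
  "Vert v \<in> lpa_gens H \<longleftrightarrow> v \<in> verts H"
  "Edge h i j \<in> lpa_gens H \<longleftrightarrow> (h, i, j) \<in> edge_indices H"
  "Ghost h i j \<in> lpa_gens H \<longleftrightarrow> (h, i, j) \<in> edge_indices H"
  by (auto simp: lpa_gens_def)

lemma edge_indices_iff [simp]:
  "(h, i, j) \<in> edge_indices H \<longleftrightarrow>
    h \<in> hyperedges H \<and> i \<in> {1..size (source H h)} \<and> j \<in> {1..size (target H h)}"
  by (simp add: edge_indices_def)

primrec flip :: "('v, 'e) lpa_gen \<Rightarrow> ('v, 'e) lpa_gen" where
  "flip (Vert v) = Vert v"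
| "flip (Edge h i j) = Ghost h i j"
| "flip (Ghost h i j) = Edge h i j"

lemma flip_flip: "flip (flip x) = x"
  by (cases x) simp_all

lemma flip_gens: "flip ` lpa_gens H \<subseteq> lpa_gens H"
  by (auto simp: lpa_gens_def)

primrec gen_degree :: "('v, 'e) lpa_gen \<Rightarrow> nat \<Rightarrow>\<^sub>0 int" where
  "gen_degree (Vert v) = 0"
| "gen_degree (Edge h i j) = frag_of i"
| "gen_degree (Ghost h i j) = - frag_of i"

text \<open>The argument \<open>K\<close> carries no data; it ties the coefficient field to the
  locale, since neither \<open>H\<close> nor the listings mention its type.\<close>

locale leavitt =
  fixes H :: "('v, 'e) hypergraph" and sl rl :: "'e \<Rightarrow> 'v list" and K :: "'k::field itself"
  assumes hypergraph_H: "hypergraph H" and listings: "listings H sl rl"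
begin

section \<open>Generators and relators of the Leavitt path algebra\<close>

definition src :: "'e \<Rightarrow> nat \<Rightarrow> 'v" where "src h i = sl h ! (i - 1)"

definition tgt :: "'e \<Rightarrow> nat \<Rightarrow> 'v" where "tgt h j = rl h ! (j - 1)"

abbreviation vert :: "'v \<Rightarrow> ('v, 'e) lpa_gen list \<Rightarrow>\<^sub>0 'k" where
  "vert v \<equiv> letter (Vert v)"
abbreviation edge :: "'e \<Rightarrow> nat \<Rightarrow> nat \<Rightarrow> ('v, 'e) lpa_gen list \<Rightarrow>\<^sub>0 'k" where
  "edge h i j \<equiv> letter (Edge h i j)"
abbreviation ghost :: "'e \<Rightarrow> nat \<Rightarrow> nat \<Rightarrow> ('v, 'e) lpa_gen list \<Rightarrow>\<^sub>0 'k" where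
  "ghost h i j \<equiv> letter (Ghost h i j)"
abbreviation relators :: "(('v, 'e) lpa_gen list \<Rightarrow>\<^sub>0 'k) set" where
  "relators \<equiv> lpa_relators H sl rl"

text \<open>One case per family of relators, relation (ii) contributing four. This analysis carries
  the checks of membership in the free algebra, of reversal and of homogeneity.\<close>

lemma relator_cases [consumes 1, case_names verts src_edge edge_tgt tgt_ghost ghost_src edge_ghost
    ghost_edge]:
  assumes "p \<in> relators"
  obtains u v where "u \<in> verts H" "v \<in> verts H" "p = vert u * vert v - (if u = v then vert u else 0)"
  | h i j where "(h, i, j) \<in> edge_indices H" "p = vert (src h i) * edge h i j - edge h i j"
  | h i j where "(h, i, j) \<in> edge_indices H" "p = edge h i j * vert (tgt h j) - edge h i j"
  | h i j where "(h, i, j) \<in> edge_indices H" "p = vert (tgt h j) * ghost h i j - ghost h i j"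
  | h i j where "(h, i, j) \<in> edge_indices H" "p = ghost h i j * vert (src h i) - ghost h i j"
  | h i j where "h \<in> hyperedges H" "i \<in> {1..size (source H h)}" "j \<in> {1..size (source H h)}"
      "p = (\<Sum>k = 1..size (target H h). edge h i k * ghost h j k) - (if i = j then vert (src h i) else 0)"
  | h i j where "h \<in> hyperedges H" "i \<in> {1..size (target H h)}" "j \<in> {1..size (target H h)}"
      "p = (\<Sum>k = 1..size (source H h). ghost h k i * edge h k j) - (if i = j then vert (tgt h i) else 0)"
  using assms unfolding lpa_relators_def Let_def src_def tgt_def Un_iff mem_Collect_eq
  by (elim disjE exE conjE) blast+

lemma relatorI:
  "u \<in> verts H \<Longrightarrow> v \<in> verts H \<Longrightarrow> vert u * vert v - (if u = v then vert u else 0) \<in> relators"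
  "(h, i, j) \<in> edge_indices H \<Longrightarrow> vert (src h i) * edge h i j - edge h i j \<in> relators"
  "(h, i, j) \<in> edge_indices H \<Longrightarrow> edge h i j * vert (tgt h j) - edge h i j \<in> relators"
  "(h, i, j) \<in> edge_indices H \<Longrightarrow> vert (tgt h j) * ghost h i j - ghost h i j \<in> relators"
  "(h, i, j) \<in> edge_indices H \<Longrightarrow> ghost h i j * vert (src h i) - ghost h i j \<in> relators"
  "h \<in> hyperedges H \<Longrightarrow> i' \<in> {1..size (source H h)} \<Longrightarrow> j' \<in> {1..size (source H h)} \<Longrightarrow>
    (\<Sum>k = 1..size (target H h). edge h i' k * ghost h j' k) - (if i' = j' then vert (src h i') else 0)
      \<in> relators"
  "h \<in> hyperedges H \<Longrightarrow> i'' \<in> {1..size (target H h)} \<Longrightarrow> j'' \<in> {1..size (target H h)} \<Longrightarrow>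
    (\<Sum>k = 1..size (source H h). ghost h k i'' * edge h k j'') - (if i'' = j'' then vert (tgt h i'') else 0)
      \<in> relators"
  unfolding lpa_relators_def Let_def src_def tgt_def Un_iff mem_Collect_eq by blast+

lemma src_in_verts: "h \<in> hyperedges H \<Longrightarrow> i \<in> {1..size (source H h)} \<Longrightarrow> src h i \<in> verts H"
  and tgt_in_verts: "h \<in> hyperedges H \<Longrightarrow> j \<in> {1..size (target H h)} \<Longrightarrow> tgt h j \<in> verts H"
proof -
  assume h: "h \<in> hyperedges H"
  then have mset: "mset (sl h) = source H h" "mset (rl h) = target H h"
    and verts: "set_mset (source H h) \<subseteq> verts H" "set_mset (target H h) \<subseteq> verts H"
    using hypergraph_H listings by (auto simp: hypergraph_def listings_def)
  show "src h i \<in> verts H" if "i \<in> {1..size (source H h)}"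
  proof -
    \<comment> \<open>The size of the source is the length of its listing, so an index from 1 to
      that size, lowered by 1, is a valid list position.\<close>
    have "src h i \<in> set (sl h)"
      using that by (unfold src_def, intro nth_mem) (auto simp flip: mset(1))
    then show ?thesis
      using verts(1) by (auto simp flip: mset(1))
  qed
  show "tgt h j \<in> verts H" if "j \<in> {1..size (target H h)}"
  proof -
    have "tgt h j \<in> set (rl h)"
      using that by (unfold tgt_def, intro nth_mem) (auto simp flip: mset(2))
    then show ?thesis
      using verts(2) by (auto simp flip: mset(2))
  qed
qed

lemma relators_free_algebra: "relators \<subseteq> free_algebra (lpa_gens H)"
proof
  fix p assume "p \<in> relators"
  then show "p \<in> free_algebra (lpa_gens H)"
    by (cases rule: relator_cases)
      (auto intro!: free_algebra_diff free_algebra_sum free_algebra_mult free_algebra_letter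
        free_algebra_zero src_in_verts tgt_in_verts)
qed

sublocale presentation "lpa_gens H" relators
  by standard (rule relators_free_algebra)

lemma generator_cases [consumes 1, case_names Vert Edge Ghost]:
  assumes "x \<in> lpa_gens H"
  obtains v where "x = Vert v" "v \<in> verts H"
  | h i j where "x = Edge h i j" "(h, i, j) \<in> edge_indices H"
  | h i j where "x = Ghost h i j" "(h, i, j) \<in> edge_indices H"
  using assms by (cases x) auto

section \<open>Vertices acting on generators\<close>

primrec left_vertex :: "('v, 'e) lpa_gen \<Rightarrow> 'v" where
  "left_vertex (Vert v) = v"
| "left_vertex (Edge h i j) = src h i"
| "left_vertex (Ghost h i j) = tgt h j"

text \<open>Starring a generator exchanges its two ends, so the right end is the left end of the
  flipped generator.\<close>

definition right_vertex :: "('v, 'e) lpa_gen \<Rightarrow> 'v" where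
  "right_vertex x = left_vertex (flip x)"

lemma left_vertex_in_verts: "x \<in> lpa_gens H \<Longrightarrow> left_vertex x \<in> verts H"
  by (erule generator_cases) (auto intro: src_in_verts tgt_in_verts)

lemma right_vertex_in_verts: "x \<in> lpa_gens H \<Longrightarrow> right_vertex x \<in> verts H"
  unfolding right_vertex_def using flip_gens by (intro left_vertex_in_verts) blast

lemma left_vertex_mult: "x \<in> lpa_gens H \<Longrightarrow> vert (left_vertex x) * letter x - letter x \<in> I"
  by (erule generator_cases)
    (use relatorI(1)[of v v for v] relatorI(2,4) in \<open>auto intro: relation_ideal.relator\<close>)

lemma right_vertex_mult: "x \<in> lpa_gens H \<Longrightarrow> letter x * vert (right_vertex x) - letter x \<in> I"
  by (erule generator_cases)
    (use relatorI(1)[of v v for v] relatorI(3,5) in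
      \<open>auto simp: right_vertex_def intro: relation_ideal.relator\<close>)

text \<open>If \<open>v\<close> differs from the left end \<open>u\<close> of \<open>x\<close>, then
  modulo the ideal \<open>v x = v (u x) = (v u) x = 0\<close>; the right side is symmetric.\<close>

lemma vert_mult_generator:
  assumes "v \<in> verts H" "x \<in> lpa_gens H"
  shows "vert v * letter x - (if v = left_vertex x then letter x else 0) \<in> I"
    "letter x * vert v - (if v = right_vertex x then letter x else 0) \<in> I"
proof -
  have orth: "vert u * vert v \<in> I" if "u \<in> verts H" "v \<in> verts H" "u \<noteq> v" for u v
    using relation_ideal.relator[OF relatorI(1)[OF that(1,2)]] that(3) by simp
  have v: "vert v \<in> free_algebra (lpa_gens H)" and x: "letter x \<in> free_algebra (lpa_gens H)"
    using assms by (simp_all add: free_algebra_letter)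
  show "vert v * letter x - (if v = left_vertex x then letter x else 0) \<in> I"
  proof (cases "v = left_vertex x")
    case False
    let ?u = "left_vertex x"
    \<comment> \<open>This difference equals \<open>vert v * letter x\<close>. The first term is in
      the ideal by orthogonality, the second by \<open>left_vertex_mult\<close>.\<close>
    have "(vert v * vert ?u) * letter x - vert v * (vert ?u * letter x - letter x) \<in> I"
      using False assms x v
      by (intro ideal_diff relation_ideal.mult_left relation_ideal.mult_right orth
          left_vertex_mult left_vertex_in_verts) auto
    then show ?thesis using False by (simp add: algebra_simps)
  qed (simp add: left_vertex_mult assms)
  show "letter x * vert v - (if v = right_vertex x then letter x else 0) \<in> I"
  proof (cases "v = right_vertex x")
    case False
    let ?u = "right_vertex x"
    have "letter x * (vert ?u * vert v) - (letter x * vert ?u - letter x) * vert v \<in> I"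
      using False assms x v
      by (intro ideal_diff relation_ideal.mult_left relation_ideal.mult_right orth
          right_vertex_mult right_vertex_in_verts) auto
    then show ?thesis using False by (simp add: algebra_simps)
  qed (simp add: right_vertex_mult assms)
qed

section \<open>Sums of vertices as units\<close>

definition vert_sum :: "'v set \<Rightarrow> ('v, 'e) lpa_gen list \<Rightarrow>\<^sub>0 'k" where
  "vert_sum W = (\<Sum>v\<in>W. vert v)"

lemma vert_sum_free: "W \<subseteq> verts H \<Longrightarrow> vert_sum W \<in> free_algebra (lpa_gens H)"
  unfolding vert_sum_def by (intro free_algebra_sum free_algebra_letter) auto

text \<open>Sum the previous congruences over \<open>W\<close>: exactly one of the conditional terms
  survives, the one at the end vertex of \<open>x\<close>.\<close>

lemma vert_sum_mult_generator:
  assumes W: "finite W" "W \<subseteq> verts H" and x: "x \<in> lpa_gens H"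
  shows "left_vertex x \<in> W \<Longrightarrow> vert_sum W * letter x - letter x \<in> I"
    "right_vertex x \<in> W \<Longrightarrow> letter x * vert_sum W - letter x \<in> I"
proof -
  have "(\<Sum>v\<in>W. vert v * letter x - (if v = left_vertex x then letter x else 0)) \<in> I"
    using W(2) x by (intro ideal_sum vert_mult_generator) auto
  then show "vert_sum W * letter x - letter x \<in> I" if "left_vertex x \<in> W"
    using that W(1) by (simp add: vert_sum_def sum_subtractf sum_distrib_right)
  have "(\<Sum>v\<in>W. letter x * vert v - (if v = right_vertex x then letter x else 0)) \<in> I"
    using W(2) x by (intro ideal_sum vert_mult_generator) auto
  then show "letter x * vert_sum W - letter x \<in> I" if "right_vertex x \<in> W"
    using that W(1) by (simp add: vert_sum_def sum_subtractf sum_distrib_left)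
qed

lemma vert_sum_unit:
  assumes W: "finite W" "W \<subseteq> verts H" and p: "p \<in> free_algebra (lpa_gens H)"
    and contains: "\<And>w. w \<in> Poly_Mapping.keys p \<Longrightarrow> left_vertex (hd w) \<in> W \<and> right_vertex (last w) \<in> W"
  shows "vert_sum W * p - p \<in> I" "p * vert_sum W - p \<in> I"
proof -
  have gens: "hd w \<in> lpa_gens H \<and> last w \<in> lpa_gens H" if "w \<in> Poly_Mapping.keys p" for w
  proof -
    have "w \<noteq> []" "set w \<subseteq> lpa_gens H"
      using p that by (auto simp: free_algebra_def)
    then show ?thesis by auto
  qed
  show "vert_sum W * p - p \<in> I"
    by (rule left_unit[OF p]) (use gens contains in \<open>blast intro: vert_sum_mult_generator(1)[OF W]\<close>)
  show "p * vert_sum W - p \<in> I"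
    by (rule right_unit[OF p]) (use gens contains in \<open>blast intro: vert_sum_mult_generator(2)[OF W]\<close>)
qed

lemma finsum_vert:
  "finite W \<Longrightarrow> W \<subseteq> verts H \<Longrightarrow> (\<Oplus>\<^bsub>A\<^esub>v\<in>W. \<pi> (vert v)) = \<pi> (vert_sum W)"
  unfolding vert_sum_def by (intro finsum_presented free_algebra_letter) auto

lemma ring_leavitt:
  assumes "finite (verts H)"
  shows "ring (A\<lparr>one := \<pi> (vert_sum (verts H))\<rparr>)"
proof (rule ring_presented)
  fix p :: "('v, 'e) lpa_gen list \<Rightarrow>\<^sub>0 'k" assume p: "p \<in> free_algebra (lpa_gens H)"
  have contains: "left_vertex (hd w) \<in> verts H \<and> right_vertex (last w) \<in> verts H"
    if "w \<in> Poly_Mapping.keys p" for w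
  proof -
    have "w \<noteq> []" "set w \<subseteq> lpa_gens H"
      using p that by (auto simp: free_algebra_def)
    then show ?thesis by (simp add: left_vertex_in_verts right_vertex_in_verts subset_iff)
  qed
  show "vert_sum (verts H) * p - p \<in> I" "p * vert_sum (verts H) - p \<in> I"
    by (rule vert_sum_unit[OF assms subset_refl p contains], assumption)+
qed (simp add: vert_sum_free)

text \<open>The sum acts as a unit on itself, because its words are single vertices of
  \<open>W\<close> and a vertex is both its own left and right end.\<close>

lemma vert_sum_idempotent:
  assumes "finite W" "W \<subseteq> verts H"
  shows "vert_sum W * vert_sum W - vert_sum W \<in> I"
proof (rule vert_sum_unit)
  fix w assume "w \<in> Poly_Mapping.keys (vert_sum W)"
  then obtain v where "v \<in> W" "w = [Vert v]"
    using Poly_Mapping.keys_sum[of vert W] by (auto simp: vert_sum_def letter_def)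
  then show "left_vertex (hd w) \<in> W \<and> right_vertex (last w) \<in> W"
    by (simp add: right_vertex_def)
qed (use assms in \<open>simp_all add: vert_sum_free\<close>)

lemma local_units:
  "set_of_local_units A {\<Oplus>\<^bsub>A\<^esub>v\<in>W. \<pi> (vert v) | W. finite W \<and> W \<subseteq> verts H}" (is "set_of_local_units A ?Y")
  unfolding set_of_local_units_def
proof (intro conjI allI impI ballI)
  show "?Y \<subseteq> carrier A"
    by (auto simp: finsum_vert residue_class_closed vert_sum_free)
next
  fix x assume "x \<in> ?Y"
  then obtain W where "finite W" "W \<subseteq> verts H" "x = \<pi> (vert_sum W)"
    by (auto simp: finsum_vert)
  then show "x \<otimes>\<^bsub>A\<^esub> x = x"
    by (simp add: mult_presented vert_sum_free residue_class_eq_iff vert_sum_idempotent)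
next
  fix S assume S: "finite S \<and> S \<subseteq> carrier A"
  then have "\<forall>s\<in>S. \<exists>p. p \<in> free_algebra (lpa_gens H) \<and> s = \<pi> p"
    by (auto simp: carrier_presented)
  then obtain \<rho> where \<rho>: "\<And>s. s \<in> S \<Longrightarrow> \<rho> s \<in> free_algebra (lpa_gens H)" "\<And>s. s \<in> S \<Longrightarrow> s = \<pi> (\<rho> s)"
    by metis
  \<comment> \<open>The action of a vertex sum on a word depends only on its end letters. Finitely
    many representatives, each with finitely many words, give a finite \<open>W\<close>.\<close>
  define W where "W = (\<Union>s\<in>S. \<Union>w\<in>Poly_Mapping.keys (\<rho> s). {left_vertex (hd w), right_vertex (last w)})"
  have W: "finite W" using S by (simp add: W_def)
  \<comment> \<open>Words in \<open>free_algebra\<close> are nonempty, so \<open>hd w\<close> and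
    \<open>last w\<close> are genuine generators.\<close>
  have "left_vertex (hd w) \<in> verts H \<and> right_vertex (last w) \<in> verts H"
    if "s \<in> S" "w \<in> Poly_Mapping.keys (\<rho> s)" for s w
  proof -
    have "w \<noteq> []" "set w \<subseteq> lpa_gens H"
      using \<rho>(1)[OF that(1)] that(2) by (auto simp: free_algebra_def)
    then show ?thesis by (simp add: left_vertex_in_verts right_vertex_in_verts subset_iff)
  qed
  then have WH: "W \<subseteq> verts H" by (auto simp: W_def)
  let ?e = "\<pi> (vert_sum W)"
  have "(?e \<otimes>\<^bsub>A\<^esub> s) \<otimes>\<^bsub>A\<^esub> ?e = s" if s: "s \<in> S" for s
  proof -
    have "left_vertex (hd w) \<in> W \<and> right_vertex (last w) \<in> W"
      if "w \<in> Poly_Mapping.keys (\<rho> s)" for w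
      using s that by (auto simp: W_def)
    note vert_sum_unit[OF W WH \<rho>(1)[OF s] this]
    then have "\<pi> (vert_sum W * \<rho> s) = \<pi> (\<rho> s)" "\<pi> (\<rho> s * vert_sum W) = \<pi> (\<rho> s)"
      by (simp_all add: residue_class_eq_iff)
    then have "?e \<otimes>\<^bsub>A\<^esub> \<pi> (\<rho> s) = \<pi> (\<rho> s)" "\<pi> (\<rho> s) \<otimes>\<^bsub>A\<^esub> ?e = \<pi> (\<rho> s)"
      by (simp_all add: mult_presented vert_sum_free WH \<rho>(1) s)
    then show ?thesis using \<rho>(2)[OF s] by simp
  qed
  moreover have "?e \<in> ?Y" using W WH finsum_vert by blast
  ultimately show "\<exists>x\<in>?Y. \<forall>s\<in>S. (x \<otimes>\<^bsub>A\<^esub> s) \<otimes>\<^bsub>A\<^esub> x = s" by blast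
qed

text \<open>The four families of (ii) are exchanged in pairs; the other three are each kept, with
  the two indices transposed, because the star of \<open>h_ik h_jk*\<close> is
  \<open>h_jk h_ik*\<close>.\<close>

lemma reversal_relator:
  assumes "p \<in> relators"
  shows "reversal flip p \<in> relators"
proof -
  note reversal = reversal_zero[OF flip_flip] reversal_diff[OF flip_flip]
    reversal_mult[OF flip_flip] reversal_sum[OF flip_flip] reversal_letter[OF flip_flip]
  show ?thesis
    using assms
  proof (cases rule: relator_cases)
    case (verts u v)
    \<comment> \<open>The delta term may be rewritten with \<open>v\<close> in place of
      \<open>u\<close>, since it is nonzero only if they agree.\<close>
    have "reversal flip p = vert v * vert u - (if v = u then vert v else 0)"
      unfolding verts(3) by (auto simp: reversal)
    then show ?thesis using relatorI(1) verts(1,2) by metis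
  next
    case (edge_ghost h i j)
    have "reversal flip p = (\<Sum>k = 1..size (target H h). edge h j k * ghost h i k)
        - (if j = i then vert (src h j) else 0)"
      unfolding edge_ghost(4) by (auto simp: reversal)
    then show ?thesis using relatorI(6)[OF edge_ghost(1,3,2)] by simp
  next
    case (ghost_edge h i j)
    have "reversal flip p = (\<Sum>k = 1..size (source H h). ghost h k j * edge h k i)
        - (if j = i then vert (tgt h j) else 0)"
      unfolding ghost_edge(4) by (auto simp: reversal)
    then show ?thesis using relatorI(7)[OF ghost_edge(1,3,2)] by simp
  qed (simp_all add: reversal relatorI)
qed

lemma relator_homogeneous:
  assumes "p \<in> relators"
  shows "\<exists>g. p \<in> homogeneous gen_degree g"
  using assms
proof (cases rule: relator_cases)
  case (verts u v)
  have "p \<in> homogeneous gen_degree (0 + 0)"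
    unfolding verts(3)
    using homogeneous_letter[of "Vert _" gen_degree]
    by (intro homogeneous_diff homogeneous_mult) (auto intro: homogeneous_zero)
  then show ?thesis ..
next
  case (src_edge h i j)
  have "p \<in> homogeneous gen_degree (0 + frag_of i)"
    unfolding src_edge(2)
    using homogeneous_letter[of "Vert _" gen_degree] homogeneous_letter[of "Edge _ i _" gen_degree]
    by (intro homogeneous_diff homogeneous_mult) auto
  then show ?thesis ..
next
  case (edge_tgt h i j)
  have "p \<in> homogeneous gen_degree (frag_of i + 0)"
    unfolding edge_tgt(2)
    using homogeneous_letter[of "Vert _" gen_degree] homogeneous_letter[of "Edge _ i _" gen_degree]
    by (intro homogeneous_diff homogeneous_mult) auto
  then show ?thesis ..
next
  case (tgt_ghost h i j)
  have "p \<in> homogeneous gen_degree (0 + - frag_of i)"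
    unfolding tgt_ghost(2)
    using homogeneous_letter[of "Vert _" gen_degree] homogeneous_letter[of "Ghost _ i _" gen_degree]
    by (intro homogeneous_diff homogeneous_mult) auto
  then show ?thesis ..
next
  case (ghost_src h i j)
  have "p \<in> homogeneous gen_degree (- frag_of i + 0)"
    unfolding ghost_src(2)
    using homogeneous_letter[of "Vert _" gen_degree] homogeneous_letter[of "Ghost _ i _" gen_degree]
    by (intro homogeneous_diff homogeneous_mult) auto
  then show ?thesis ..
next
  case (edge_ghost h i j)
  \<comment> \<open>For \<open>i = j\<close> this degree is 0, the degree of the vertex in the delta
    term; otherwise that term is 0, which is homogeneous of every degree.\<close>
  have "p \<in> homogeneous gen_degree (frag_of i + - frag_of j)"
    unfolding edge_ghost(4)
    using homogeneous_letter[of "Edge _ i _" gen_degree] homogeneous_letter[of "Ghost _ j _" gen_degree]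
      homogeneous_letter[of "Vert _" gen_degree]
    by (intro homogeneous_diff homogeneous_sum homogeneous_mult) (auto intro: homogeneous_zero)
  then show ?thesis ..
next
  case (ghost_edge h i j)
  \<comment> \<open>The expression for the degree depends on \<open>k\<close>, so each summand must
    be seen to have degree 0 before \<open>homogeneous_sum\<close> applies.\<close>
  have "ghost h k i * edge h k j \<in> homogeneous gen_degree (- frag_of k + frag_of k)" for k
    using homogeneous_letter[of "Edge _ k _" gen_degree] homogeneous_letter[of "Ghost _ k _" gen_degree]
    by (intro homogeneous_mult) auto
  then have "p \<in> homogeneous gen_degree 0"
    unfolding ghost_edge(4)
    using homogeneous_letter[of "Vert _" gen_degree]
    by (intro homogeneous_diff homogeneous_sum) (auto intro: homogeneous_zero)
  then show ?thesis ..
qed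

lemma graded_leavitt:
  assumes "n = (SUP h\<in>hyperedges H. enat (size (source H h)))"
  shows "graded_presentation (lpa_gens H) relators {i. 1 \<le> i \<and> enat i \<le> n} gen_degree"
proof
  fix x assume "x \<in> lpa_gens H"
  \<comment> \<open>The basis vector attached to an edge or ghost generator has a source index,
    which is bounded by the supremum, finite or not.\<close>
  moreover have "enat i \<le> n" if "h \<in> hyperedges H" "i \<le> size (source H h)" for h i
    unfolding assms using that by (intro SUP_upper2[of h]) auto
  ultimately show "Poly_Mapping.keys (gen_degree x) \<subseteq> {i. 1 \<le> i \<and> enat i \<le> n}"
    by (cases rule: generator_cases) (auto simp: keys_frag_of)
qed (rule relator_homogeneous)

end

theorem proposition7:
  fixes H :: "('v, 'e) hypergraph"
    and sl rl :: "'e \<Rightarrow> 'v list"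
    and L :: "('k::field, (('v, 'e) lpa_gen list \<Rightarrow>\<^sub>0 'k) set) module"
    and \<gamma> :: "('v, 'e) lpa_gen \<Rightarrow> (('v, 'e) lpa_gen list \<Rightarrow>\<^sub>0 'k) set"
    and n :: enat
  assumes "hypergraph H"
    and "listings H sl rl"
    and "L = leavitt_path_algebra H sl rl"
    and "\<gamma> = lpa_generator H sl rl"
    and "n = (SUP h\<in>hyperedges H. enat (size (source H h)))"
  shows "(set_of_local_units L {\<Oplus>\<^bsub>L\<^esub>v\<in>A. \<gamma> (Vert v) | A. finite A \<and> A \<subseteq> verts H} \<and>
          (finite_hypergraph H \<longrightarrow> ring (L\<lparr>one := \<Oplus>\<^bsub>L\<^esub>v\<in>verts H. \<gamma> (Vert v)\<rparr>))) \<and>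
         (\<exists>f. linear_involution L f \<and>
           (\<forall>v\<in>verts H. f (\<gamma> (Vert v)) = \<gamma> (Vert v)) \<and>
           (\<forall>(h, i, j)\<in>edge_indices H. f (\<gamma> (Edge h i j)) = \<gamma> (Ghost h i j) \<and>
              f (\<gamma> (Ghost h i j)) = \<gamma> (Edge h i j))) \<and>
         (\<exists>D. algebra_grading (int_power n) L D \<and>
           (\<forall>v\<in>verts H. \<gamma> (Vert v) \<in> D 0) \<and>
           (\<forall>(h, i, j)\<in>edge_indices H. \<gamma> (Edge h i j) \<in> D (frag_of i) \<and>
              \<gamma> (Ghost h i j) \<in> D (- frag_of i)))"
proof -
  interpret leavitt H sl rl "TYPE('k)"
    using assms(1,2) by unfold_locales
  have L: "L = A" and \<gamma>: "\<gamma> x = \<pi> (letter x)" for x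
    using assms(3,4) by (simp_all add: leavitt_path_algebra_def lpa_generator_def)
  interpret grading: graded_presentation "lpa_gens H" relators "{i. 1 \<le> i \<and> enat i \<le> n}" gen_degree
    using assms(5) by (rule graded_leavitt)
  have unital: "ring (L\<lparr>one := \<Oplus>\<^bsub>L\<^esub>v\<in>verts H. \<gamma> (Vert v)\<rparr>)" if "finite_hypergraph H"
    using that ring_leavitt by (simp add: L \<gamma> finite_hypergraph_def finsum_vert)
  obtain f where f: "linear_involution L f" "\<And>p. f (\<pi> p) = \<pi> (reversal flip p)"
    using linear_involution_presented[OF flip_flip flip_gens]
      relation_ideal.relator[OF reversal_relator] unfolding L by blast
  have "linear_involution L f \<and> (\<forall>v\<in>verts H. f (\<gamma> (Vert v)) = \<gamma> (Vert v)) \<and>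
      (\<forall>(h, i, j)\<in>edge_indices H. f (\<gamma> (Edge h i j)) = \<gamma> (Ghost h i j) \<and>
        f (\<gamma> (Ghost h i j)) = \<gamma> (Edge h i j))"
    using f(1) by (auto simp: \<gamma> f(2) reversal_letter[OF flip_flip])
  moreover have "algebra_grading (int_power n) L grading.part \<and>
      (\<forall>v\<in>verts H. \<gamma> (Vert v) \<in> grading.part 0) \<and>
      (\<forall>(h, i, j)\<in>edge_indices H. \<gamma> (Edge h i j) \<in> grading.part (frag_of i) \<and>
        \<gamma> (Ghost h i j) \<in> grading.part (- frag_of i))"
    using grading.algebra_grading_part grading.generator_part[of "Vert _"]
      grading.generator_part[of "Edge _ _ _"] grading.generator_part[of "Ghost _ _ _"]
    by (auto simp: L \<gamma> int_power_def)
  ultimately show ?thesis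
    using local_units unital unfolding L \<gamma> by blast
qed

end
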